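(* Each of the following pairs $(F,f)$ satisfies the structure condition (SC) on $\Omega\subset\mathbb{R}^n$. (1) $$F(p,X)=-\operatorname{tr}\left[\left(I-\frac{p\otimes p}{1+|p|^2}\right)X\right],\qquad f(\varphi',\varphi'')=-\frac{\varphi''}{1+(\varphi')^2}.$$ (2) $F(t,p,X)=-\operatorname{tr}(A(p,t)X)$, where $A(p,t)=(a_{ij}(p,t))$ is a symmetric-matrix-valued function such that $F$ is continuous and degenerate elliptic, and there exists a continuous function $\alpha(R,t)$, $R\ge0$, such that for all $R>0$ and all $t$ $$0<\alpha(R,t)\le R^2\inf_{|p|=R,\ v\cdot p\ne0}\frac{v^TA(p,t)v}{(v\cdot p)^2};$$ and $f(t,\varphi',\varphi'')=-\alpha(|\varphi'|,t)\varphi''$.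
   Context: $S(n)$ is the set of symmetric $n\times n$ real matrices with its usual order; $p\otimes q$ is the matrix with entries $p_iq_j$. $F$ is degenerate elliptic if $F(t,x,r,p,X)\le F(t,x,r,p,Y)$ whenever $Y\le X$. Primes denote derivatives in $s$. Structure condition (SC) for $(F,f)$ on $\Omega$: for every smooth function $\varphi=\varphi(s,t)$, $$F\left(t,y,r,\varphi'\tfrac{x-y}{|x-y|},Y\right)-F\left(t,x,v,\varphi'\tfrac{x-y}{|x-y|},X\right)\le -2f(t,s,\varphi,\varphi',\varphi'')$$ for all $t$, all $x,y\in\Omega$ with $|x-y|=2s>0$, all $v,r\in\mathbb{R}$ with $v-r=2\varphi>0$, and all $X,Y\in S(n)$ satisfying $$\begin{pmatrix}X&0\\0&-Y\end{pmatrix}\le D^2_{x,y}\left(2\varphi\left(\tfrac{|x-y|}{2},t\right)\right),$$ where $\varphi$ and its derivatives are evaluated at $(s,t)$ with $s=|x-y|/2$, and $D^2_{x,y}$ is the $2n\times 2n$ Hessian in $(x,y)$. Arguments on which $F$ or $f$ does not depend are omitted. *)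

theory Defs
  imports "HOL-Analysis.Analysis"
begin

primrec Ck_on :: "nat \<Rightarrow> 'a::real_normed_vector set \<Rightarrow> ('a \<Rightarrow> 'b::real_normed_vector) \<Rightarrow> bool" where
  "Ck_on 0 S g \<longleftrightarrow> continuous_on S g"
| "Ck_on (Suc k) S g \<longleftrightarrow>
     (\<forall>x\<in>S. g differentiable (at x)) \<and>
     (\<forall>h. Ck_on k S (\<lambda>x. frechet_derivative g (at x) h))"

text \<open>Intended for open sets only.\<close>
definition smooth_on :: "'a::real_normed_vector set \<Rightarrow> ('a \<Rightarrow> 'b::real_normed_vector) \<Rightarrow> bool" where
  "smooth_on S g \<longleftrightarrow> (\<forall>k. Ck_on k S g)"

definition sym_matrices :: "(real^'n^'n) set" where
  "sym_matrices = {X. transpose X = X}"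

definition matrix_le :: "real^'n^'n \<Rightarrow> real^'n^'n \<Rightarrow> bool" (infix "\<preceq>" 50) where
  "X \<preceq> Y \<longleftrightarrow> (\<forall>v. v \<bullet> (X *v v) \<le> v \<bullet> (Y *v v))"

definition tensor :: "real^'n \<Rightarrow> real^'n \<Rightarrow> real^'n^'n" where
  "tensor p q = (\<chi> i j. p $ i * q $ j)"

text \<open>The Hessian as the matrix of second partial derivatives; only meaningful where
  the function is twice differentiable.\<close>
definition hessian :: "(real^'m \<Rightarrow> real) \<Rightarrow> real^'m \<Rightarrow> real^'m^'m" where
  "hessian g z = (\<chi> i j.
     frechet_derivative (\<lambda>w. frechet_derivative g (at w) (axis j 1)) (at z) (axis i 1))"

text \<open>Points of \<open>\<real>\<^sup>2\<^sup>n\<close> are vectors indexed by \<^typ>\<open>'n + 'n\<close>: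
  the \<^const>\<open>Inl\<close> coordinates are those of \<open>x\<close>, the \<^const>\<open>Inr\<close> coordinates those of \<open>y\<close>.\<close>
definition pair_vec :: "real^'n \<Rightarrow> real^'n \<Rightarrow> real^('n + 'n)" where
  "pair_vec x y = (\<chi> i. case i of Inl k \<Rightarrow> x $ k | Inr k \<Rightarrow> y $ k)"

definition fst_vec :: "real^('n + 'n) \<Rightarrow> real^'n" where
  "fst_vec z = (\<chi> k. z $ Inl k)"

definition snd_vec :: "real^('n + 'n) \<Rightarrow> real^'n" where
  "snd_vec z = (\<chi> k. z $ Inr k)"

definition block_diag :: "real^'n^'n \<Rightarrow> real^'n^'n \<Rightarrow> real^('n + 'n)^('n + 'n)" where
  "block_diag X Y = (\<chi> i j. case (i, j) of
       (Inl k, Inl l) \<Rightarrow> X $ k $ l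
     | (Inr k, Inr l) \<Rightarrow> Y $ k $ l
     | _ \<Rightarrow> 0)"

text \<open>Below \<open>J\<close> is the set of times over which \<open>t\<close> ranges and \<open>\<Omega>\<close> the spatial domain;
  \<open>F\<close> takes the arguments \<open>t, x, r, p, X\<close>, and \<open>f\<close> the arguments \<open>t, s, \<phi>, \<phi>', \<phi>''\<close>.\<close>

definition degenerate_elliptic ::
  "real set \<Rightarrow> (real^'n) set \<Rightarrow>
   (real \<Rightarrow> real^'n \<Rightarrow> real \<Rightarrow> real^'n \<Rightarrow> real^'n^'n \<Rightarrow> real) \<Rightarrow> bool" where
  "degenerate_elliptic J \<Omega> F \<longleftrightarrow>
     (\<forall>t\<in>J. \<forall>x\<in>\<Omega>. \<forall>r p. \<forall>X\<in>sym_matrices. \<forall>Y\<in>sym_matrices.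
        Y \<preceq> X \<longrightarrow> F t x r p X \<le> F t x r p Y)"

text \<open>The smooth function \<open>\<phi>\<close> may be defined only on an open set \<open>U\<close> of pairs \<open>(s, t)\<close>;
  the condition is then imposed at the points of \<open>U\<close>. It depends only on the germ
  of \<open>\<phi>\<close> at \<open>(s, t)\<close>.\<close>
definition structure_condition ::
  "real set \<Rightarrow> (real^'n) set \<Rightarrow>
   (real \<Rightarrow> real^'n \<Rightarrow> real \<Rightarrow> real^'n \<Rightarrow> real^'n^'n \<Rightarrow> real) \<Rightarrow>
   (real \<Rightarrow> real \<Rightarrow> real \<Rightarrow> real \<Rightarrow> real \<Rightarrow> real) \<Rightarrow> bool" where
  "structure_condition J \<Omega> F f \<longleftrightarrow>
     (\<forall>U (\<phi> :: real \<Rightarrow> real \<Rightarrow> real). open U \<longrightarrow> smooth_on U (\<lambda>(s, t). \<phi> s t) \<longrightarrow>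
       (\<forall>t\<in>J. \<forall>x\<in>\<Omega>. \<forall>y\<in>\<Omega>. \<forall>s v r. \<forall>X\<in>sym_matrices. \<forall>Y\<in>sym_matrices.
          (s, t) \<in> U \<longrightarrow>
          norm (x - y) = 2 * s \<longrightarrow> s > 0 \<longrightarrow>
          v - r = 2 * \<phi> s t \<longrightarrow> \<phi> s t > 0 \<longrightarrow>
          block_diag X (- Y) \<preceq>
            hessian (\<lambda>z. 2 * \<phi> (norm (fst_vec z - snd_vec z) / 2) t) (pair_vec x y) \<longrightarrow>
          (let \<phi>1 = deriv (\<lambda>\<sigma>. \<phi> \<sigma> t) s;
               \<phi>2 = (deriv ^^ 2) (\<lambda>\<sigma>. \<phi> \<sigma> t) s;
               p = (\<phi>1 / norm (x - y)) *\<^sub>R (x - y)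
           in F t y r p Y - F t x v p X \<le> - 2 * f t s (\<phi> s t) \<phi>1 \<phi>2)))"

end

theory Submission
  imports Defs
begin

text \<open>Write \<open>e = (x - y) / |x - y|\<close> and let \<open>H\<close> be the Hessian in the matrix inequality for \<open>X\<close>
  and \<open>Y\<close>. Testing that inequality on vectors \<open>(\<xi>, \<xi>)\<close>, where \<open>H\<close> vanishes, gives \<open>X \<le> Y\<close>;
  testing it on \<open>(e, -e)\<close> gives \<open>e\<^sup>T (X - Y) e \<le> 2 \<phi>''\<close>. In both cases
  \<open>A - \<alpha> e \<otimes> e\<close> is positive semidefinite (in case (2) at \<open>\<phi>' = 0\<close> by letting the
  gradient \<open>R e\<close> tend to \<open>0\<close>), so
  \<open>tr (A (X - Y)) \<le> \<alpha> tr ((e \<otimes> e) (X - Y)) \<le> 2 \<alpha> \<phi>''\<close>.\<close>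

section \<open>Traces of products of positive semidefinite matrices\<close>

lemma tensor_mult_vec: "tensor p q *v v = (q \<bullet> v) *\<^sub>R p"
  by (simp add: vec_eq_iff tensor_def matrix_vector_mult_def inner_vec_def sum_distrib_left
      mult_ac)

lemma trace_mult_tensor: "trace (B ** tensor p q) = q \<bullet> (B *v p)"
  by (simp add: trace_def tensor_def matrix_matrix_mult_def matrix_vector_mult_def inner_vec_def
      sum_distrib_left mult_ac)

text \<open>Used to peel a rank-one term off \<open>Z\<close> in the elimination below and later,
  with the factors exchanged under the trace, off \<open>A\<close>.\<close>

lemma trace_mult_add_scaleR_tensor:
  "trace (B ** (Z + c *\<^sub>R tensor p q)) = trace (B ** Z) + c * (q \<bullet> (B *v p))"
proof -
  have "trace (B ** (c *\<^sub>R tensor p q)) = c * trace (B ** tensor p q)"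
    by (simp add: trace_def matrix_matrix_mult_def sum_distrib_left mult_ac)
  then show ?thesis
    by (simp add: matrix_add_ldistrib trace_add trace_mult_tensor)
qed

lemma sym_matrices_iff_nth: "Z \<in> sym_matrices \<longleftrightarrow> (\<forall>i j. Z $ i $ j = Z $ j $ i)"
  by (auto simp: sym_matrices_def transpose_def vec_eq_iff)

lemma sym_matrices_inner_commute:
  assumes "Z \<in> sym_matrices"
  shows "u \<bullet> (Z *v v) = v \<bullet> (Z *v u)"
  using assms dot_lmul_matrix[of u Z v] transpose_matrix_vector[of Z u]
  by (simp add: sym_matrices_def inner_commute)

text \<open>At \<open>l *\<^sub>R u + k *\<^sub>R v\<close> the form of \<open>Z\<close> is a
  nonnegative binary quadratic form in \<open>l\<close> and \<open>k\<close>, so its discriminant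
  cannot be positive.\<close>

lemma psd_Cauchy_Schwarz:
  fixes Z :: "real^'n^'n"
  assumes sym: "Z \<in> sym_matrices" and psd: "\<And>v. 0 \<le> v \<bullet> (Z *v v)"
  shows "(u \<bullet> (Z *v v))\<^sup>2 \<le> (u \<bullet> (Z *v u)) * (v \<bullet> (Z *v v))"
proof -
  define a b c where "a = u \<bullet> (Z *v u)" "b = u \<bullet> (Z *v v)" "c = v \<bullet> (Z *v v)"
  have q: "0 \<le> l\<^sup>2 * a + 2 * l * k * b + k\<^sup>2 * c" for l k
    using psd[of "l *\<^sub>R u + k *\<^sub>R v"] sym_matrices_inner_commute[OF sym, of v u]
    by (simp add: a_b_c_def matrix_vector_right_distrib matrix_vector_mult_scaleR
        inner_add_left inner_add_right power2_eq_square algebra_simps)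
  have "a \<ge> 0" "c \<ge> 0"
    using psd by (auto simp: a_b_c_def)
  have "b\<^sup>2 \<le> a * c"
  proof (cases "a = 0")
    case False
    \<comment> \<open>The pair \<open>(- b, a)\<close> is, up to scale, the minimiser in
      \<open>l\<close> for fixed \<open>k\<close>.\<close>
    have "0 \<le> a * (a * c - b\<^sup>2)"
      using q[of "- b" a] by (simp add: power2_eq_square algebra_simps)
    then show ?thesis
      using False \<open>a \<ge> 0\<close> by (simp add: zero_le_mult_iff)
  next
    case True
    \<comment> \<open>With \<open>a = 0\<close> the form is linear in \<open>l\<close>, so a large
      negative multiple of \<open>b\<close> for \<open>l\<close> forces \<open>b = 0\<close>; the
      factor \<open>c + 1\<close> outweighs the term in \<open>c\<close>.\<close>
    have "0 \<le> - (c + 2) * b\<^sup>2"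
      using q[of "- (c + 1)" b] True by (simp add: power2_eq_square algebra_simps)
    then have "b\<^sup>2 \<le> 0"
      using \<open>c \<ge> 0\<close> by (simp add: zero_le_mult_iff)
    then show ?thesis
      using True by simp
  qed
  then show ?thesis
    by (simp add: a_b_c_def)
qed

text \<open>Cholesky elimination: subtracting the rank-one matrix \<open>Z e\<^sub>i \<otimes> Z e\<^sub>i / Z\<^sub>i\<^sub>i\<close> keeps \<open>Z\<close>
  positive semidefinite and lowers the number of nonzero diagonal entries.\<close>

lemma trace_mult_psd_nonneg:
  fixes B Z :: "real^'n^'n"
  assumes B: "\<And>v. 0 \<le> v \<bullet> (B *v v)"
    and "Z \<in> sym_matrices" "\<And>v. 0 \<le> v \<bullet> (Z *v v)"
  shows "0 \<le> trace (B ** Z)"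
  using assms(2,3)
proof (induction "card {i. Z $ i $ i \<noteq> 0}" arbitrary: Z rule: less_induct)
  case less
  note sym = less.prems(1) and psd = less.prems(2)
  have entry: "axis i 1 \<bullet> (Z *v axis j 1) = Z $ i $ j" for i j
    by (simp add: inner_axis' matrix_vector_mult_basis column_def)
  have CS: "(Z $ i $ j)\<^sup>2 \<le> Z $ i $ i * Z $ j $ j" for i j
    using psd_Cauchy_Schwarz[OF sym psd, of "axis i 1" "axis j 1"] by (simp add: entry)
  show ?case
  proof (cases "\<exists>i. Z $ i $ i \<noteq> 0")
    case False
    \<comment> \<open>By \<open>CS\<close>, a zero diagonal makes every entry vanish.\<close>
    then have "Z = 0"
      using CS by (simp add: vec_eq_iff)
    then show ?thesis
      by (simp add: trace_def)
  next
    case True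
    then obtain i where i: "Z $ i $ i \<noteq> 0"
      by blast
    have "Z $ i $ i \<ge> 0"
      using psd[of "axis i 1"] by (simp add: entry)
    then have pos: "Z $ i $ i > 0"
      using i by simp
    define w where "w = Z *v axis i 1"
    have w: "w $ j = Z $ j $ i" for j
      by (simp add: w_def matrix_vector_mult_basis column_def)
    define Z' where "Z' = Z - (1 / Z $ i $ i) *\<^sub>R tensor w w"
    have Z': "Z' $ j $ k = Z $ j $ k - Z $ j $ i * Z $ k $ i / Z $ i $ i" for j k
      by (simp add: Z'_def tensor_def w)
    have sym': "Z' \<in> sym_matrices"
      using sym by (simp add: sym_matrices_iff_nth Z' mult.commute)
    \<comment> \<open>Passing to \<open>Z'\<close> subtracts
      \<open>(v \<bullet> w)\<^sup>2 / Z $ i $ i\<close> from the form, and Cauchy-Schwarz against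
      \<open>axis i 1\<close> bounds exactly this term.\<close>
    have psd': "0 \<le> v \<bullet> (Z' *v v)" for v
    proof -
      have "(v \<bullet> w)\<^sup>2 \<le> Z $ i $ i * (v \<bullet> (Z *v v))"
        using psd_Cauchy_Schwarz[OF sym psd, of v "axis i 1"]
        by (simp add: entry w_def mult.commute)
      then show ?thesis
        using pos
        by (simp add: Z'_def matrix_vector_mult_diff_rdistrib scaleR_matrix_vector_assoc[symmetric]
            tensor_mult_vec inner_diff_right inner_commute field_simps power2_eq_square)
    qed
    \<comment> \<open>A zero diagonal entry stays zero because \<open>CS\<close> makes
      \<open>Z $ j $ i\<close> vanish; entry \<open>i\<close> becomes zero, so the measure drops
      strictly.\<close>
    have "Z' $ j $ j = 0" if "Z $ j $ j = 0" for j
      using CS[of j i] that by (simp add: Z')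
    moreover have "Z' $ i $ i = 0"
      using i by (simp add: Z')
    ultimately have "{j. Z' $ j $ j \<noteq> 0} \<subset> {j. Z $ j $ j \<noteq> 0}"
      using i by auto
    then have "card {j. Z' $ j $ j \<noteq> 0} < card {j. Z $ j $ j \<noteq> 0}"
      by (simp add: psubset_card_mono)
    then have "0 \<le> trace (B ** Z')"
      using less.hyps sym' psd' by blast
    moreover have "Z = Z' + (1 / Z $ i $ i) *\<^sub>R tensor w w"
      by (simp add: Z'_def)
    then have "trace (B ** Z) = trace (B ** Z') + (w \<bullet> (B *v w)) / Z $ i $ i"
      using trace_mult_add_scaleR_tensor[of B Z' "1 / Z $ i $ i" w w] by simp
    ultimately show ?thesis
      using B[of w] pos by simp
  qed
qed

section \<open>The Hessian of a radial function of the difference\<close>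

text \<open>Turns Frechet smoothness in \<open>(s, t)\<close> into ordinary derivatives of the slice
  at fixed \<open>t\<close>. The first derivative is supplied on a neighbourhood because the Hessian
  computation differentiates it again.\<close>

lemma smooth_on_imp_DERIV_partial:
  fixes \<phi> :: "real \<Rightarrow> real \<Rightarrow> real"
  assumes "open U" "smooth_on U (\<lambda>(s, t). \<phi> s t)" "(s, t) \<in> U"
  obtains S where "open S" "s \<in> S"
    "\<And>\<sigma>. \<sigma> \<in> S \<Longrightarrow> ((\<lambda>\<sigma>. \<phi> \<sigma> t) has_real_derivative deriv (\<lambda>\<sigma>. \<phi> \<sigma> t) \<sigma>) (at \<sigma>)"
    "(deriv (\<lambda>\<sigma>. \<phi> \<sigma> t) has_real_derivative (deriv ^^ 2) (\<lambda>\<sigma>. \<phi> \<sigma> t) s) (at s)"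
proof -
  let ?G = "\<lambda>(s, t). \<phi> s t"
  define D where "D = (\<lambda>x. frechet_derivative ?G (at x) (1, 0))"
  have "Ck_on 2 U ?G"
    using assms by (auto simp: smooth_on_def)
  then have G: "\<And>x. x \<in> U \<Longrightarrow> ?G differentiable at x"
    and D: "\<And>x. x \<in> U \<Longrightarrow> D differentiable at x"
    by (auto simp: numeral_2_eq_2 D_def)
  \<comment> \<open>Chain rule along the line of constant \<open>t\<close>, needed both for the
    function and for its partial derivative \<open>D\<close>.\<close>
  have partial: "((\<lambda>\<sigma>. g (\<sigma>, t)) has_real_derivative frechet_derivative g (at (\<sigma>, t)) (1, 0)) (at \<sigma>)"
    if "g differentiable at (\<sigma>, t)" for g :: "real \<times> real \<Rightarrow> real" and \<sigma>
  proof -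
    let ?g' = "frechet_derivative g (at (\<sigma>, t))"
    have g': "(g has_derivative ?g') (at (\<sigma>, t))"
      using that frechet_derivative_works by blast
    have "((\<lambda>\<sigma>. (\<sigma>, t)) has_derivative (\<lambda>h. (h, 0))) (at \<sigma>)"
      by (auto intro!: derivative_eq_intros)
    from diff_chain_at[OF this g']
    have "((\<lambda>\<sigma>. g (\<sigma>, t)) has_derivative (\<lambda>h. ?g' (h, 0))) (at \<sigma>)"
      by (simp add: o_def)
    moreover have "(\<lambda>h. ?g' (h, 0)) = (*) (?g' (1, 0))"
    proof
      show "?g' (h, 0) = ?g' (1, 0) * h" for h
        using linear_cmul[OF has_derivative_linear[OF g'], of h "(1, 0)"] by simp
    qed
    ultimately show ?thesis
      by (simp only: has_field_derivative_def)
  qed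
  define S where "S = {\<sigma>. (\<sigma>, t) \<in> U}"
  have "open S"
  proof -
    have "S = (\<lambda>\<sigma>. (\<sigma>, t)) -` U"
      by (auto simp: S_def)
    then show ?thesis
      using assms(1) by (auto intro!: open_vimage continuous_intros)
  qed
  have "s \<in> S"
    using assms by (simp add: S_def)
  have 1: "((\<lambda>\<sigma>. \<phi> \<sigma> t) has_real_derivative D (\<sigma>, t)) (at \<sigma>)" if "\<sigma> \<in> S" for \<sigma>
    using partial[OF G, of \<sigma>] that by (simp add: S_def D_def)
  have eq: "deriv (\<lambda>\<sigma>. \<phi> \<sigma> t) \<sigma> = D (\<sigma>, t)" if "\<sigma> \<in> S" for \<sigma>
    using DERIV_imp_deriv[OF 1[OF that]] .
  define d where "d = frechet_derivative D (at (s, t)) (1, 0)"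
  have "((\<lambda>\<sigma>. D (\<sigma>, t)) has_real_derivative d) (at s)"
    unfolding d_def using partial[OF D] assms by blast
  then have 2: "(deriv (\<lambda>\<sigma>. \<phi> \<sigma> t) has_real_derivative d) (at s)"
    by (rule has_field_derivative_transform_within_open[OF _ \<open>open S\<close> \<open>s \<in> S\<close>]) (simp add: eq)
  show thesis
    by (rule that[OF \<open>open S\<close> \<open>s \<in> S\<close>])
      (use 1 eq 2 DERIV_imp_deriv[OF 2] in \<open>simp_all add: numeral_2_eq_2\<close>)
qed

lemma has_derivative_radial:
  fixes L :: "'a::real_normed_vector \<Rightarrow> 'b::real_inner" and h :: "real \<Rightarrow> real"
  assumes L: "bounded_linear L" and "L w \<noteq> 0"
    and h: "(h has_real_derivative d) (at (norm (L w) / 2))"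
  shows "((\<lambda>z. h (norm (L z) / 2)) has_derivative
    (\<lambda>k. d * ((L w \<bullet> L k) / (2 * norm (L w))))) (at w)"
proof -
  have "((\<lambda>z. norm (L z)) has_derivative (\<lambda>k. L k \<bullet> sgn (L w))) (at w)"
    using diff_chain_at[OF bounded_linear_imp_has_derivative[OF L] has_derivative_norm[OF \<open>L w \<noteq> 0\<close>]]
    by (simp add: o_def)
  then have "((\<lambda>z. norm (L z) / 2) has_derivative (\<lambda>k. (L k \<bullet> sgn (L w)) / 2)) (at w)"
    by (rule bounded_linear.has_derivative[OF bounded_linear_divide])
  from diff_chain_at[OF this h[unfolded has_field_derivative_def]]
  show ?thesis
    by (simp add: o_def sgn_div_norm inner_commute field_simps)
qed

text \<open>A radial function \<psi>(|w|) has second derivative \<psi>'' along \<open>w\<close> and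
  \<psi>'/|w| across it; for \<psi>(\<rho>) = 2 h(\<rho>/2) the former is \<open>d2 / 2\<close>. The
  latter, \<open>b\<close>, may stay unspecified: both kinds of test vectors used later annihilate
  its term. The map \<open>L\<close> will be the difference of the two halves of a vector.\<close>

lemma hessian_radial_quadratic_form:
  fixes L :: "real^'m \<Rightarrow> 'b::real_inner" and h h' :: "real \<Rightarrow> real"
  assumes L: "bounded_linear L" and z: "L z \<noteq> 0"
    and S: "open S" "norm (L z) / 2 \<in> S"
    and h: "\<And>\<sigma>. \<sigma> \<in> S \<Longrightarrow> (h has_real_derivative h' \<sigma>) (at \<sigma>)"
    and h': "(h' has_real_derivative d2) (at (norm (L z) / 2))"
  obtains b where "\<And>v. v \<bullet> (hessian (\<lambda>w. 2 * h (norm (L w) / 2)) z *v v)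
    = d2 / 2 * (L z \<bullet> L v)\<^sup>2 / (norm (L z))\<^sup>2
      + b * ((norm (L v))\<^sup>2 - (L z \<bullet> L v)\<^sup>2 / (norm (L z))\<^sup>2)"
proof -
  define g where "g = (\<lambda>w. 2 * h (norm (L w) / 2))"
  \<comment> \<open>The formula for the first derivative must hold on an open set around
    \<open>z\<close> before it can be differentiated there.\<close>
  define W where "W = {w. L w \<noteq> 0 \<and> norm (L w) / 2 \<in> S}"
  have contL: "continuous_on UNIV L"
    using L by (simp add: linear_continuous_on)
  have "W = (L -` (- {0})) \<inter> ((\<lambda>w. norm (L w) / 2) -` S)"
    by (auto simp: W_def)
  then have "open W"
    using contL S(1) by (auto intro!: open_Int open_vimage continuous_intros)
  have "z \<in> W"
    using z S by (simp add: W_def)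
  have D1: "frechet_derivative g (at w) k = h' (norm (L w) / 2) * ((L w \<bullet> L k) / norm (L w))"
    if "w \<in> W" for w k
  proof -
    have "(g has_derivative (\<lambda>k. 2 * (h' (norm (L w) / 2) * ((L w \<bullet> L k) / (2 * norm (L w)))))) (at w)"
      unfolding g_def
      by (rule has_derivative_mult_right[OF has_derivative_radial[OF L]])
        (use that h in \<open>auto simp: W_def\<close>)
    from frechet_derivative_at[OF this] show ?thesis
      by (simp add: fun_eq_iff)
  qed
  define N where "N = norm (L z)"
  have N: "N > 0"
    using z by (simp add: N_def)
  define b where "b = h' (N / 2) / N"
  \<comment> \<open>The polarised form of the claimed quadratic form, to be matched with mixed
    second derivatives.\<close>
  define Q where "Q = (\<lambda>k j. d2 / 2 * ((L z \<bullet> L k) * (L z \<bullet> L j)) / N\<^sup>2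
    + b * (L k \<bullet> L j - (L z \<bullet> L k) * (L z \<bullet> L j) / N\<^sup>2))"
  have D2: "frechet_derivative (\<lambda>w. frechet_derivative g (at w) j) (at z) k = Q k j" for j k
  proof -
    have dh: "((\<lambda>w. h' (norm (L w) / 2)) has_derivative (\<lambda>k. d2 * ((L z \<bullet> L k) / (2 * N)))) (at z)"
      unfolding N_def by (rule has_derivative_radial[OF L z h'])
    \<comment> \<open>Doubling as the profile undoes the division by 2 and leaves the norm
      itself.\<close>
    have dn: "((\<lambda>w. norm (L w)) has_derivative (\<lambda>k. (L z \<bullet> L k) / N)) (at z)"
      using has_derivative_radial[OF L z, of "\<lambda>x. 2 * x" 2]
      by (auto simp: N_def intro!: derivative_eq_intros)
    have dL: "((\<lambda>w. L w \<bullet> L j) has_derivative (\<lambda>k. L k \<bullet> L j)) (at z)"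
      by (rule has_derivative_inner_left[OF bounded_linear_imp_has_derivative[OF L]])
    have "((\<lambda>w. h' (norm (L w) / 2) * ((L w \<bullet> L j) / norm (L w))) has_derivative (\<lambda>k. Q k j)) (at z)"
      by (rule derivative_eq_intros dh dn dL refl)+
        (use z N in \<open>auto simp: N_def[symmetric] Q_def b_def field_simps power2_eq_square\<close>)
    then have "((\<lambda>w. frechet_derivative g (at w) j) has_derivative (\<lambda>k. Q k j)) (at z)"
      by (rule has_derivative_transform_within_open[OF _ \<open>open W\<close> \<open>z \<in> W\<close>]) (simp add: D1)
    from frechet_derivative_at[OF this] show ?thesis
      by (simp add: fun_eq_iff)
  qed
  have Lv: "L v = (\<Sum>i\<in>UNIV. v $ i *\<^sub>R L (axis i 1))" for v
  proof -
    have "L v = L (\<Sum>i\<in>UNIV. v $ i *\<^sub>R axis i 1)"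
      by (simp add: basis_expansion flip: scalar_mult_eq_scaleR)
    then show ?thesis
      using L by (simp add: bounded_linear.linear linear_sum linear_cmul)
  qed
  \<comment> \<open>The Hessian is given by its entries on coordinate axes, so \<open>v\<close> is
    expanded in both slots of the bilinear \<open>Q\<close>.\<close>
  have form: "v \<bullet> (hessian g z *v v) = Q v v" for v
  proof -
    have "linear L"
      using L by (simp add: bounded_linear.linear)
    then have lin: "linear (\<lambda>k. Q k j)" "linear (Q k)" for k j
      by (auto intro!: linearI simp: Q_def linear_add linear_cmul inner_add_left inner_add_right
          add_divide_distrib diff_divide_distrib ring_distribs mult_ac)
    have v: "v = (\<Sum>i\<in>UNIV. v $ i *\<^sub>R axis i 1)"
      by (simp add: basis_expansion flip: scalar_mult_eq_scaleR)
    have "Q v v = (\<Sum>i\<in>UNIV. v $ i * Q (axis i 1) v)"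
      by (subst v) (simp add: linear_sum[OF lin(1)] linear_cmul[OF lin(1)])
    also have "\<dots> = (\<Sum>i\<in>UNIV. v $ i * (\<Sum>j\<in>UNIV. v $ j * Q (axis i 1) (axis j 1)))"
      by (subst (2) v) (simp add: linear_sum[OF lin(2)] linear_cmul[OF lin(2)])
    also have "\<dots> = v \<bullet> (hessian g z *v v)"
      by (simp add: hessian_def D2 inner_vec_def matrix_vector_mult_def mult.commute)
    finally show ?thesis ..
  qed
  show thesis
    by (rule that[of b])
      (simp add: form[unfolded g_def] Q_def N_def power2_eq_square dot_square_norm)
qed

section \<open>The structure condition for trace operators\<close>

lemma inner_pair_vec_block_diag:
  "pair_vec a b \<bullet> (block_diag X Y *v pair_vec a b) = a \<bullet> (X *v a) + b \<bullet> (Y *v b)"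
proof -
  have sum_Plus: "(\<Sum>i\<in>UNIV. f i) = (\<Sum>i\<in>UNIV. f (Inl i)) + (\<Sum>i\<in>UNIV. f (Inr i))"
    for f :: "'a::finite + 'a \<Rightarrow> real"
    by (subst UNIV_Plus_UNIV[symmetric], subst sum.Plus) (auto simp: o_def)
  show ?thesis
    by (simp add: inner_vec_def matrix_vector_mult_def sum_Plus pair_vec_def block_diag_def)
qed

text \<open>The common core of both cases. Here \<open>c\<close> is the signed \<phi>', so that the
  gradient is \<open>c *\<^sub>R e\<close> with a direction \<open>e\<close> that survives when
  \<phi>' vanishes. The premise on \<Omega> is there because ellipticity quantifies over points of
  \<Omega> and says nothing about \<open>A\<close> if there are none.\<close>

lemma structure_condition_trace:
  fixes A :: "real^'n \<Rightarrow> real \<Rightarrow> real^'n^'n" and a :: "real \<Rightarrow> real \<Rightarrow> real"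
  assumes nonneg: "\<And>c t. t \<in> J \<Longrightarrow> \<Omega> \<noteq> {} \<Longrightarrow> 0 \<le> a c t"
    and lower: "\<And>c t e v. t \<in> J \<Longrightarrow> \<Omega> \<noteq> {} \<Longrightarrow> norm e = 1 \<Longrightarrow>
      a c t * (v \<bullet> e)\<^sup>2 \<le> v \<bullet> (A (c *\<^sub>R e) t *v v)"
  shows "structure_condition J \<Omega> (\<lambda>t x r p X. - trace (A p t ** X))
    (\<lambda>t s z z1 z2. - a z1 t * z2)"
  unfolding structure_condition_def Let_def
proof (intro allI ballI impI)
  fix U :: "(real \<times> real) set" and \<phi> :: "real \<Rightarrow> real \<Rightarrow> real" and t s v r :: real
    and x y :: "real^'n" and X Y :: "real^'n^'n"
  assume U: "open U" "smooth_on U (\<lambda>(s, t). \<phi> s t)" "(s, t) \<in> U"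
    and t: "t \<in> J" and x: "x \<in> \<Omega>" and XY: "X \<in> sym_matrices" "Y \<in> sym_matrices"
    and s: "norm (x - y) = 2 * s" "0 < s"
    and le: "block_diag X (- Y) \<preceq>
      hessian (\<lambda>z. 2 * \<phi> (norm (fst_vec z - snd_vec z) / 2) t) (pair_vec x y)"
  let ?h = "\<lambda>\<sigma>. \<phi> \<sigma> t"
  define c where "c = deriv ?h s"
  define d2 where "d2 = (deriv ^^ 2) ?h s"
  define e where "e = (1 / norm (x - y)) *\<^sub>R (x - y)"
  have e: "norm e = 1"
    using s by (simp add: e_def)
  define L :: "real^('n + 'n) \<Rightarrow> real^'n" where "L = (\<lambda>z. fst_vec z - snd_vec z)"
  have "linear L"
    by (rule linearI) (simp_all add: L_def fst_vec_def snd_vec_def vec_eq_iff algebra_simps)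
  then have L: "bounded_linear L"
    by (simp add: linear_conv_bounded_linear)
  have L_pair: "L (pair_vec a b) = a - b" for a b
    by (simp add: L_def fst_vec_def snd_vec_def pair_vec_def vec_eq_iff)
  obtain S where S: "open S" "s \<in> S"
    and 1: "\<And>\<sigma>. \<sigma> \<in> S \<Longrightarrow> (?h has_real_derivative deriv ?h \<sigma>) (at \<sigma>)"
    and 2: "(deriv ?h has_real_derivative d2) (at s)"
    unfolding d2_def using smooth_on_imp_DERIV_partial[OF U] by blast
  obtain b where b: "\<And>v. v \<bullet> (hessian (\<lambda>z. 2 * \<phi> (norm (L z) / 2) t) (pair_vec x y) *v v)
      = d2 / 2 * (L (pair_vec x y) \<bullet> L v)\<^sup>2 / (norm (L (pair_vec x y)))\<^sup>2
      + b * ((norm (L v))\<^sup>2 - (L (pair_vec x y) \<bullet> L v)\<^sup>2 / (norm (L (pair_vec x y)))\<^sup>2)"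
    by (rule hessian_radial_quadratic_form[OF L, of "pair_vec x y" S ?h "deriv ?h" d2])
      (use s S 1 2 in \<open>auto simp: L_pair\<close>)
  have test: "u \<bullet> (X *v u) - w \<bullet> (Y *v w) \<le> d2 / 2 * ((x - y) \<bullet> (u - w))\<^sup>2 / (norm (x - y))\<^sup>2
      + b * ((norm (u - w))\<^sup>2 - ((x - y) \<bullet> (u - w))\<^sup>2 / (norm (x - y))\<^sup>2)" for u w
  proof -
    have "w \<bullet> (- Y *v w) = - (w \<bullet> (Y *v w))"
      by (simp add: matrix_vector_mult_def inner_vec_def sum_negf)
    then have "u \<bullet> (X *v u) - w \<bullet> (Y *v w) = pair_vec u w \<bullet> (block_diag X (- Y) *v pair_vec u w)"
      by (simp add: inner_pair_vec_block_diag)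
    also have "\<dots> \<le> pair_vec u w \<bullet>
        (hessian (\<lambda>z. 2 * \<phi> (norm (L z) / 2) t) (pair_vec x y) *v pair_vec u w)"
      using le unfolding matrix_le_def L_def by blast
    finally show ?thesis
      by (simp only: b L_pair)
  qed
  define Z where "Z = Y - X"
  have Z_sym: "Z \<in> sym_matrices"
    using XY by (simp add: Z_def sym_matrices_iff_nth)
  \<comment> \<open>On \<open>(u, u)\<close> the difference is zero and the whole right-hand side of
    \<open>test\<close> vanishes.\<close>
  have Z: "0 \<le> u \<bullet> (Z *v u)" for u
    using test[of u u] by (simp add: Z_def matrix_vector_mult_diff_rdistrib inner_diff_right)
  have "(x - y) \<bullet> e = norm (x - y)"
    using s by (simp add: e_def dot_square_norm power2_eq_square)
  moreover have "e - - e = 2 *\<^sub>R e"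
    by (simp add: scaleR_2)
  \<comment> \<open>On \<open>(e, - e)\<close> the difference is \<open>2 *\<^sub>R e\<close>: the
    radial term is \<open>d2 / 2\<close> times 4, and the factor of \<open>b\<close> is 4 -
    4.\<close>
  ultimately have "e \<bullet> (X *v e) - (- e) \<bullet> (Y *v (- e)) \<le> 2 * d2"
    using test[of e "- e"] s e by (simp add: power_mult_distrib)
  then have Ze: "- (e \<bullet> (Z *v e)) \<le> 2 * d2"
    by (simp add: Z_def matrix_vector_mult_diff_rdistrib inner_diff_right vec.neg)
  define B where "B = A (c *\<^sub>R e) t - a c t *\<^sub>R tensor e e"
  have "0 \<le> u \<bullet> (B *v u)" for u
    using lower[OF t _ e, of c u] x
    by (auto simp: B_def matrix_vector_mult_diff_rdistrib scaleR_matrix_vector_assoc[symmetric]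
        tensor_mult_vec inner_diff_right inner_commute power2_eq_square mult_ac)
  from trace_mult_psd_nonneg[OF this Z_sym Z]
  have "0 \<le> trace (B ** Z)" .
  moreover have "A (c *\<^sub>R e) t = B + a c t *\<^sub>R tensor e e"
    by (simp add: B_def)
  \<comment> \<open>The splitting lemma wants the rank-one term in the second factor, hence the
    exchange under the trace.\<close>
  then have "trace (A (c *\<^sub>R e) t ** Z) = trace (B ** Z) + a c t * (e \<bullet> (Z *v e))"
    using trace_mult_add_scaleR_tensor[of Z B "a c t" e e]
    by (simp add: trace_mul_sym[of _ Z])
  ultimately have "- trace (A (c *\<^sub>R e) t ** Z) \<le> a c t * (- (e \<bullet> (Z *v e)))"
    by simp
  \<comment> \<open>The sign of \<open>a c t\<close> matters here: it multiplies the inequality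
    \<open>Ze\<close>.\<close>
  also have "\<dots> \<le> a c t * (2 * d2)"
    using Ze nonneg[OF t] x by (intro mult_left_mono) auto
  finally have "- trace (A (c *\<^sub>R e) t ** Z) \<le> 2 * (a c t * d2)"
    by simp
  moreover have "trace (A (c *\<^sub>R e) t ** Z) = trace (A (c *\<^sub>R e) t ** Y) - trace (A (c *\<^sub>R e) t ** X)"
    using matrix_add_ldistrib[of "A (c *\<^sub>R e) t" Z X] by (simp add: Z_def trace_add)
  moreover have "(deriv ?h s / norm (x - y)) *\<^sub>R (x - y) = c *\<^sub>R e"
    by (simp add: c_def e_def)
  ultimately show "- trace (A ((deriv ?h s / norm (x - y)) *\<^sub>R (x - y)) t ** Y)
      - - trace (A ((deriv ?h s / norm (x - y)) *\<^sub>R (x - y)) t ** X)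
      \<le> - 2 * (- a (deriv ?h s) t * (deriv ^^ 2) ?h s)"
    by (simp add: c_def d2_def)
qed

section \<open>The mean curvature operator and general quasilinear operators\<close>

lemma tensor_self_sym: "tensor v v \<in> sym_matrices"
  by (simp add: sym_matrices_iff_nth tensor_def mult.commute)

text \<open>At the gradient \<open>c *\<^sub>R e\<close> the form is |v|^2 - c^2 (v.e)^2 / (1 +
  c^2); bounding |v|^2 below by (v.e)^2 leaves the coefficient 1 / (1 + c^2), which serves as
  \<open>a\<close>.\<close>

lemma structure_condition_mean_curvature:
  "structure_condition J \<Omega>
     (\<lambda>t x r p X. - trace ((mat 1 - (1 / (1 + (norm p)\<^sup>2)) *\<^sub>R tensor p p) ** X))
     (\<lambda>t s z z1 z2. - z2 / (1 + z1\<^sup>2))"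
proof -
  have lower: "1 / (1 + c\<^sup>2) * (v \<bullet> e)\<^sup>2
      \<le> v \<bullet> ((mat 1 - (1 / (1 + (norm (c *\<^sub>R e))\<^sup>2)) *\<^sub>R tensor (c *\<^sub>R e) (c *\<^sub>R e)) *v v)"
    if "norm e = 1" for c :: real and e v :: "real^'n"
  proof -
    have "\<bar>v \<bullet> e\<bar> \<le> norm v"
      using Cauchy_Schwarz_ineq2[of v e] that by simp
    then have "(v \<bullet> e)\<^sup>2 \<le> v \<bullet> v"
      by (metis abs_norm_cancel abs_le_square_iff dot_square_norm)
    moreover have "1 + c\<^sup>2 > 0"
      by (simp add: add_pos_nonneg)
    then have "1 / (1 + c\<^sup>2) * (v \<bullet> e)\<^sup>2 = (v \<bullet> e)\<^sup>2 - c\<^sup>2 * (v \<bullet> e)\<^sup>2 / (1 + c\<^sup>2)"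
      by (simp add: field_simps)
    ultimately show ?thesis
      using that
      by (simp add: matrix_vector_mult_diff_rdistrib scaleR_matrix_vector_assoc[symmetric]
          tensor_mult_vec inner_diff_right inner_commute power2_eq_square mult_ac)
  qed
  have "structure_condition J \<Omega>
      (\<lambda>t x r p X. - trace ((mat 1 - (1 / (1 + (norm p)\<^sup>2)) *\<^sub>R tensor p p) ** X))
      (\<lambda>t s z z1 z2. - (1 / (1 + z1\<^sup>2)) * z2)"
    by (rule structure_condition_trace, simp) (rule lower)
  then show ?thesis
    by simp
qed

text \<open>Ellipticity is applied to the ordered pair \<open>0\<close> and
  \<open>tensor v v\<close>, since the trace of \<open>A p t ** tensor v v\<close> is the quadratic
  form at \<open>v\<close>.\<close>

lemma degenerate_elliptic_trace_imp_psd: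
  assumes "degenerate_elliptic J \<Omega> (\<lambda>t x r p X. - trace (A p t ** X))" "t \<in> J" "\<Omega> \<noteq> {}"
  shows "0 \<le> v \<bullet> (A p t *v v)"
proof -
  have "0 \<preceq> tensor v v"
    by (simp add: matrix_le_def tensor_mult_vec inner_commute)
  moreover have "0 \<in> sym_matrices"
    by (simp add: sym_matrices_iff_nth)
  ultimately have "- trace (A p t ** tensor v v) \<le> - trace (A p t ** 0)"
    using assms tensor_self_sym unfolding degenerate_elliptic_def by blast
  then show ?thesis
    by (simp add: trace_mult_tensor) (simp add: trace_def)
qed

theorem proposition4p1:
  fixes J :: "real set" and \<Omega> :: "(real^'n) set"
  shows
    "structure_condition J \<Omega>
       (\<lambda>t x r p X. - trace ((mat 1 - (1 / (1 + (norm p)\<^sup>2)) *\<^sub>R tensor p p) ** X))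
       (\<lambda>t s z z1 z2. - z2 / (1 + z1\<^sup>2))
     \<and>
     (\<forall>(A :: real^'n \<Rightarrow> real \<Rightarrow> real^'n^'n) (\<alpha> :: real \<Rightarrow> real \<Rightarrow> real).
        (\<forall>p. \<forall>t\<in>J. A p t \<in> sym_matrices) \<longrightarrow>
        continuous_on (J \<times> UNIV \<times> sym_matrices) (\<lambda>(t, p, X). - trace (A p t ** X)) \<longrightarrow>
        degenerate_elliptic J \<Omega> (\<lambda>t x r p X. - trace (A p t ** X)) \<longrightarrow>
        continuous_on ({0..} \<times> J) (\<lambda>(R, t). \<alpha> R t) \<longrightarrow>
        (\<forall>R>0. \<forall>t\<in>J. 0 < \<alpha> R t \<and>
           \<alpha> R t \<le> R\<^sup>2 *
             Inf {(v \<bullet> (A p t *v v)) / (v \<bullet> p)\<^sup>2 | p v. norm p = R \<and> v \<bullet> p \<noteq> 0}) \<longrightarrow>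
        structure_condition J \<Omega>
          (\<lambda>t x r p X. - trace (A p t ** X))
          (\<lambda>t s z z1 z2. - \<alpha> \<bar>z1\<bar> t * z2))"
proof (intro conjI allI impI)
  show "structure_condition J \<Omega>
       (\<lambda>t x r p X. - trace ((mat 1 - (1 / (1 + (norm p)\<^sup>2)) *\<^sub>R tensor p p) ** X))
       (\<lambda>t s z z1 z2. - z2 / (1 + z1\<^sup>2))"
    by (rule structure_condition_mean_curvature)
next
  fix A :: "real^'n \<Rightarrow> real \<Rightarrow> real^'n^'n" and \<alpha> :: "real \<Rightarrow> real \<Rightarrow> real"
  assume contA: "continuous_on (J \<times> UNIV \<times> sym_matrices) (\<lambda>(t, p, X). - trace (A p t ** X))"
    and ell: "degenerate_elliptic J \<Omega> (\<lambda>t x r p X. - trace (A p t ** X))"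
    and cont\<alpha>: "continuous_on ({0..} \<times> J) (\<lambda>(R, t). \<alpha> R t)"
    and \<alpha>: "\<forall>R>0. \<forall>t\<in>J. 0 < \<alpha> R t \<and>
      \<alpha> R t \<le> R\<^sup>2 * Inf {(v \<bullet> (A p t *v v)) / (v \<bullet> p)\<^sup>2 | p v. norm p = R \<and> v \<bullet> p \<noteq> 0}"
  have psd: "0 \<le> v \<bullet> (A p t *v v)" if "t \<in> J" "\<Omega> \<noteq> {}" for t p v
    using degenerate_elliptic_trace_imp_psd[OF ell that] .
  have cont\<alpha>_R: "continuous_on {0..} (\<lambda>R. \<alpha> R t)" if "t \<in> J" for t
    using that by (intro continuous_on_compose2[OF cont\<alpha>, of _ "\<lambda>R. (R, t)", simplified])
      (auto intro!: continuous_intros)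
  have pos: "\<alpha> \<bar>c\<bar> t * (v \<bullet> e)\<^sup>2 \<le> v \<bullet> (A (c *\<^sub>R e) t *v v)"
    if t: "t \<in> J" and \<Omega>: "\<Omega> \<noteq> {}" and e: "norm e = 1" and c: "c \<noteq> 0" for c t e v
  proof (cases "v \<bullet> e = 0")
    case True
    then show ?thesis
      using psd[OF t \<Omega>] by simp
  next
    case False
    let ?M = "{(v \<bullet> (A p t *v v)) / (v \<bullet> p)\<^sup>2 | p v. norm p = \<bar>c\<bar> \<and> v \<bullet> p \<noteq> 0}"
    \<comment> \<open>Without a lower bound the real \<open>Inf\<close> would not be comparable with
      members of the set; ellipticity provides 0.\<close>
    have "bdd_below ?M"
      using psd[OF t \<Omega>] by (intro bdd_belowI[of _ 0]) auto
    moreover have "(v \<bullet> (A (c *\<^sub>R e) t *v v)) / (v \<bullet> (c *\<^sub>R e))\<^sup>2 \<in> ?M"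
      using c e False by (intro CollectI exI[of _ "c *\<^sub>R e"] exI[of _ v]) auto
    ultimately have "Inf ?M \<le> (v \<bullet> (A (c *\<^sub>R e) t *v v)) / (v \<bullet> (c *\<^sub>R e))\<^sup>2"
      by (rule cInf_lower[rotated])
    \<comment> \<open>The factor \<open>c\<^sup>2\<close> cancels the one in
      \<open>(v \<bullet> (c *\<^sub>R e))\<^sup>2\<close>, leaving a quotient that depends on the
      unit vector \<open>e\<close>.\<close>
    then have "c\<^sup>2 * Inf ?M \<le> c\<^sup>2 * ((v \<bullet> (A (c *\<^sub>R e) t *v v)) / (v \<bullet> (c *\<^sub>R e))\<^sup>2)"
      by (intro mult_left_mono) auto
    moreover have "\<alpha> \<bar>c\<bar> t \<le> c\<^sup>2 * Inf ?M"
      using \<alpha>[rule_format, of "\<bar>c\<bar>" t] c t by simp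
    ultimately have "\<alpha> \<bar>c\<bar> t \<le> (v \<bullet> (A (c *\<^sub>R e) t *v v)) / (v \<bullet> e)\<^sup>2"
      using c by (simp add: power_mult_distrib)
    then show ?thesis
      using False by (simp add: pos_le_divide_eq)
  qed
  \<comment> \<open>The infimum hypothesis covers only positive radii, so the bound at zero gradient
    is the limit of \<open>pos\<close> along the ray through \<open>e\<close>.\<close>
  have zero: "\<alpha> 0 t * (v \<bullet> e)\<^sup>2 \<le> v \<bullet> (A 0 t *v v)"
    if t: "t \<in> J" and \<Omega>: "\<Omega> \<noteq> {}" and e: "norm e = 1" for t e v
  proof -
    \<comment> \<open>Continuity is assumed of the operator, not of \<open>A\<close>; inserting
      \<open>tensor v v\<close> for the matrix argument recovers it for the quadratic form at
      \<open>v\<close>.\<close>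
    have "continuous_on {0..} (\<lambda>R. - trace (A (R *\<^sub>R e) t ** tensor v v))"
      using t tensor_self_sym[of v]
      by (intro continuous_on_compose2[OF contA, of _ "\<lambda>R. (t, R *\<^sub>R e, tensor v v)", simplified])
        (auto intro!: continuous_intros)
    from continuous_on_minus[OF this]
    have "continuous_on {0..} (\<lambda>R. v \<bullet> (A (R *\<^sub>R e) t *v v) - \<alpha> R t * (v \<bullet> e)\<^sup>2)"
      by (intro continuous_on_diff continuous_on_mult_right cont\<alpha>_R t) (simp add: trace_mult_tensor)
    then have "continuous_on (closure {0<..}) (\<lambda>R. v \<bullet> (A (R *\<^sub>R e) t *v v) - \<alpha> R t * (v \<bullet> e)\<^sup>2)"
      by simp
    then have "0 \<le> v \<bullet> (A (0 *\<^sub>R e) t *v v) - \<alpha> 0 t * (v \<bullet> e)\<^sup>2"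
    proof (rule continuous_ge_on_closure)
      show "0 \<le> v \<bullet> (A (R *\<^sub>R e) t *v v) - \<alpha> R t * (v \<bullet> e)\<^sup>2" if "R \<in> {0<..}" for R
        using pos[OF t \<Omega> e, of R v] that by simp
    qed simp
    then show ?thesis
      by simp
  qed
  \<comment> \<open>A limit of positive values; strict positivity may be lost, but the core lemma
    asks only for a nonnegative coefficient.\<close>
  have zero_nonneg: "0 \<le> \<alpha> 0 t" if t: "t \<in> J" for t
    using continuous_ge_on_closure[of "{0<..}" "\<lambda>R. \<alpha> R t" 0 0] cont\<alpha>_R[OF t] \<alpha> t
    by (simp add: less_imp_le)
  show "structure_condition J \<Omega> (\<lambda>t x r p X. - trace (A p t ** X))
      (\<lambda>t s z z1 z2. - \<alpha> \<bar>z1\<bar> t * z2)"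
  proof (rule structure_condition_trace)
    show "0 \<le> \<alpha> \<bar>c\<bar> t" if "t \<in> J" for c t
      using zero_nonneg[OF that] \<alpha>[rule_format, of "\<bar>c\<bar>" t] that by (cases "c = 0") simp_all
    show "\<alpha> \<bar>c\<bar> t * (v \<bullet> e)\<^sup>2 \<le> v \<bullet> (A (c *\<^sub>R e) t *v v)"
      if "t \<in> J" "\<Omega> \<noteq> {}" "norm e = 1" for c t e v
      using pos[OF that, of c v] zero[OF that, of v] by (cases "c = 0") simp_all
  qed
qed

end
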